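(* Let $k$ and $\ell$ be given positive integers such that $\gcd(\ell, k^2+1)=1$. Call a pair $(x,y)$ of positive integers a solution if $$\arctan\left(\frac{1}{x}\right)+\arctan\left(\frac{\ell}{y}\right)=\arctan\left(\frac{1}{k}\right)\quad\text{and}\quad \gcd(\ell,y)=1.$$ Then the following hold. (a) There are exactly $N$ distinct solutions $(x,y)$, where $N$ is the number of positive integer divisors of $k^2+1$. Specifically, if $(x,y)$ is a solution, then $$x=k+\ell\cdot\left(\frac{k^2+1}{d}\right)\quad\text{and}\quad y=k\ell+d,$$ where $d$ is a positive integer divisor of $k^2+1$. (b) If $k^2+1=p$ is a prime number, then there are exactly two distinct solutions, namely $$(x,y)=(k+\ell(k^2+1),\ k\ell+1)\quad\text{and}\quad (x,y)=(k+\ell,\ k\ell+k^2+1).$$ (c) If $k^2+1=p_1p_2$ is a product of two distinct primes $p_1$ and $p_2$, then there are exactly four distinct solutions, namely $$(x,y)=(k+\ell(k^2+1),\ k\ell+1),\quad (k+\ell,\ k\ell+k^2+1),\quad (k+\ell p_2,\ k\ell+p_1),\quad (k+\ell p_1,\ k\ell+p_2).$$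
   Context: Here $\arctan$ is the real arctangent function with values in $(-\pi/2,\pi/2)$. *)

theory Defs
  imports Complex_Main "HOL-Computational_Algebra.Primes"
begin

definition solutions :: "nat \<Rightarrow> nat \<Rightarrow> (nat \<times> nat) set" where
  "solutions k l = {(x, y). x > 0 \<and> y > 0
     \<and> arctan (1 / real x) + arctan (real l / real y) = arctan (1 / real k)
     \<and> gcd l y = 1}"

end

theory Submission
  imports Defs
begin

text \<open>
  By the addition formula for the arctangent, the equation becomes
  \<open>k (y + l x) = x y - l\<close>, that is, \<open>(x - k) (y - k l) = l (k\<^sup>2 + 1)\<close>.
  Both factors are positive, and \<open>d = y - k l\<close> is coprime to \<open>l\<close> exactly when \<open>y\<close> is; hence
  \<open>d\<close> divides \<open>k\<^sup>2 + 1\<close>, and every divisor arises.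
\<close>

text \<open>The unknowns are shifted to the excesses \<open>m = x - k\<close> and
  \<open>d = y - k * l\<close>, so that the factored equation involves no truncated subtraction;
  positivity of both excesses also keeps the addition formula valid.\<close>

lemma arctan_equation_iff:
  fixes k l m d :: nat
  assumes "k > 0" "l > 0" "m > 0" "d > 0"
  shows "arctan (1 / real (k + m)) + arctan (real l / real (k * l + d)) = arctan (1 / real k)
    \<longleftrightarrow> m * d = l * (k\<^sup>2 + 1)"
proof -
  define x y where "x = real (k + m)" and "y = real (k * l + d)"
  have x: "x > 1"
    using assms by (simp add: x_def)
  have "l \<le> k * l"
    using \<open>k > 0\<close> by simp
  then have "l < k * l + d"
    using \<open>d > 0\<close> by linarith
  then have y: "real l < y" "y > 0"
    unfolding y_def by linarith+
  \<comment> \<open>Equivalently \<open>1 / x * (real l / y) < 1\<close>, so the denominators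
    cleared below are positive.\<close>
  have "real l < x * y"
    using mult_strict_mono[of 1 x "real l" y] x y by simp
  have "arctan (1 / x) + arctan (real l / y) = arctan ((1 / x + real l / y) / (1 - 1 / x * (real l / y)))"
    using x y by (intro arctan_add) auto
  moreover have "(1 / x + real l / y) / (1 - 1 / x * (real l / y)) = (y + l * x) / (x * y - l)"
    using x y \<open>real l < x * y\<close> by (simp add: divide_simps)
  ultimately have "arctan (1 / x) + arctan (real l / y) = arctan (1 / real k)
      \<longleftrightarrow> (y + l * x) / (x * y - l) = 1 / real k"
    by (simp add: arctan_eq_iff)
  also have "\<dots> \<longleftrightarrow> real k * (y + l * x) = x * y - l"
    using \<open>k > 0\<close> \<open>real l < x * y\<close> by (simp add: divide_simps mult.commute)
  \<comment> \<open>Expanding in \<open>m\<close> and \<open>d\<close>, the difference of the two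
    sides is \<open>m * d - l * (k\<^sup>2 + 1)\<close>, up to sign.\<close>
  also have "\<dots> \<longleftrightarrow> real (m * d) = real (l * (k\<^sup>2 + 1))"
    by (auto simp: x_def y_def algebra_simps power2_eq_square)
  finally show ?thesis
    unfolding x_def y_def of_nat_eq_iff .
qed

text \<open>Both summands are positive, so each is smaller than the right-hand side, and
  monotonicity of \<open>arctan\<close> compares the arguments. This makes the shift to positive
  excesses available for every solution.\<close>

lemma arctan_equation_bounds:
  fixes k l x y :: nat
  assumes "k > 0" "l > 0" "x > 0" "y > 0"
    and eq: "arctan (1 / real x) + arctan (real l / real y) = arctan (1 / real k)"
  shows "x > k" "y > k * l"
proof -
  have "arctan (1 / real x) > 0" "arctan (real l / real y) > 0"
    using assms by simp_all
  then have "arctan (1 / real x) < arctan (1 / real k)" "arctan (real l / real y) < arctan (1 / real k)"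
    using eq by linarith+
  then have "1 / real x < 1 / real k" "real l / real y < 1 / real k"
    by (simp_all only: arctan_less_iff)
  then have "real k < real x" "real (k * l) < real y"
    using assms by (simp_all add: field_simps)
  then show "x > k" "y > k * l"
    by (simp_all only: of_nat_less_iff)
qed

lemma solutions_eq_image:
  fixes k l :: nat
  assumes "k > 0" "l > 0" "coprime l (k\<^sup>2 + 1)"
  shows "solutions k l = (\<lambda>d. (k + l * ((k\<^sup>2 + 1) div d), k * l + d)) ` {d. d dvd k\<^sup>2 + 1}"
    (is "_ = ?f ` ?D")
proof (intro equalityI subsetI)
  fix s
  assume "s \<in> solutions k l"
  then obtain x y where s: "s = (x, y)" "x > 0" "y > 0" "coprime l y"
    and eq: "arctan (1 / real x) + arctan (real l / real y) = arctan (1 / real k)"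
    by (auto simp: solutions_def coprime_iff_gcd_eq_1)
  obtain m d where xy: "x = k + m" "m > 0" "y = k * l + d" "d > 0"
    using arctan_equation_bounds[OF assms(1,2) s(2,3) eq] less_imp_add_positive by metis
  have md: "m * d = l * (k\<^sup>2 + 1)"
    using arctan_equation_iff[OF assms(1,2) \<open>m > 0\<close> \<open>d > 0\<close>] eq xy by simp
  \<comment> \<open>Removing the multiple \<open>k * l\<close> of \<open>l\<close> from
    \<open>y\<close> leaves the gcd with \<open>l\<close> unchanged.\<close>
  have "coprime d l"
    using s(4) unfolding xy by (simp add: coprime_iff_gcd_eq_1 gcd_add_mult gcd.commute)
  moreover have "d dvd l * (k\<^sup>2 + 1)"
    using md by (metis dvd_triv_right)
  ultimately have d: "d dvd k\<^sup>2 + 1"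
    by (simp only: coprime_dvd_mult_right_iff)
  \<comment> \<open>The product is rewritten with an explicit factor \<open>d\<close>, which is then
    cancelled to determine \<open>m\<close>.\<close>
  then have "m * d = l * ((k\<^sup>2 + 1) div d) * d"
    using md by (simp only: mult.assoc dvd_div_mult_self)
  then have "m = l * ((k\<^sup>2 + 1) div d)"
    using \<open>d > 0\<close> by simp
  then show "s \<in> ?f ` ?D"
    using d s xy by blast
next
  fix s
  assume "s \<in> ?f ` ?D"
  then obtain d where d: "d dvd k\<^sup>2 + 1" and s: "s = ?f d"
    by blast
  have "d > 0"
    using d by (auto intro: Nat.gr0I)
  \<comment> \<open>Since \<open>d \<le> k\<^sup>2 + 1\<close>, the quotient is at least 1; this is
    the positive excess \<open>m\<close> that the equivalence requires.\<close>
  moreover have q: "l * ((k\<^sup>2 + 1) div d) > 0"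
    using d \<open>l > 0\<close> \<open>d > 0\<close> dvd_imp_le[OF d] by (simp add: div_greater_zero_iff)
  moreover have "l * ((k\<^sup>2 + 1) div d) * d = l * (k\<^sup>2 + 1)"
    using d by (simp only: mult.assoc dvd_div_mult_self)
  \<comment> \<open>Coprimality of \<open>l\<close> and \<open>k\<^sup>2 + 1\<close> passes to the
    divisor \<open>d\<close>, and adding a multiple of \<open>l\<close> preserves it.\<close>
  moreover have "coprime l (k * l + d)"
    using coprime_divisors[OF dvd_refl d assms(3)]
    by (simp add: coprime_iff_gcd_eq_1 gcd_add_mult)
  ultimately show "s \<in> solutions k l"
    using arctan_equation_iff[OF assms(1,2) q \<open>d > 0\<close>] \<open>k > 0\<close>
    unfolding s solutions_def coprime_iff_gcd_eq_1 by simp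
qed

lemma divisors_of_prime_nat:
  fixes p :: nat
  assumes "prime p"
  shows "{d. d dvd p} = {1, p}"
  using assms by (auto simp: prime_nat_iff)

text \<open>A divisor of a product splits into a divisor of each factor, and each prime leaves two
  choices. If \<open>p = q\<close>, the listed set merely collapses.\<close>

lemma divisors_of_prime_mult_prime_nat:
  fixes p q :: nat
  assumes "prime p" "prime q"
  shows "{d. d dvd p * q} = {1, p * q, p, q}"
proof (intro equalityI subsetI)
  fix d
  assume "d \<in> {d. d dvd p * q}"
  then obtain a b where "d = a * b" "a dvd p" "b dvd q"
    by (auto elim: dvd_productE)
  moreover from this have "a \<in> {1, p}" "b \<in> {1, q}"
    using assms by (auto simp: prime_nat_iff)
  ultimately show "d \<in> {1, p * q, p, q}"
    by auto
qed auto

theorem theorem1: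
  fixes k l :: nat
  assumes "k > 0" and "l > 0" and "gcd l (k^2 + 1) = 1"
  shows "(finite (solutions k l)
      \<and> card (solutions k l) = card {d::nat. d > 0 \<and> d dvd k^2 + 1}
      \<and> (\<forall>(x, y) \<in> solutions k l. \<exists>d::nat. d > 0 \<and> d dvd k^2 + 1
            \<and> x = k + l * ((k^2 + 1) div d) \<and> y = k * l + d))
    \<and> (prime (k^2 + 1) \<longrightarrow>
        card (solutions k l) = 2
      \<and> solutions k l = {(k + l * (k^2 + 1), k * l + 1), (k + l, k * l + (k^2 + 1))})
    \<and> (\<forall>p1 p2 :: nat. prime p1 \<and> prime p2 \<and> p1 \<noteq> p2 \<and> k^2 + 1 = p1 * p2 \<longrightarrow>
        card (solutions k l) = 4
      \<and> solutions k l = {(k + l * (k^2 + 1), k * l + 1), (k + l, k * l + (k^2 + 1)),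
                          (k + l * p2, k * l + p1), (k + l * p1, k * l + p2)})"
proof -
  define n where "n = k\<^sup>2 + 1"
  define D where "D = {d. d dvd n}"
  define f where "f d = (k + l * (n div d), k * l + d)" for d
  have "n > 0"
    by (simp add: n_def)
  have D_pos: "d > 0" if "d dvd n" for d
    using that \<open>n > 0\<close> by (rule dvd_pos_nat[rotated])
  then have D: "{d. d > 0 \<and> d dvd n} = D"
    by (auto simp: D_def)
  have sol: "solutions k l = f ` D"
    using solutions_eq_image[of k l] assms
    unfolding f_def D_def n_def coprime_iff_gcd_eq_1 by blast
  have "finite D"
    unfolding D_def using \<open>n > 0\<close> by simp
  \<comment> \<open>The second coordinate \<open>k * l + d\<close> already determines
    \<open>d\<close>.\<close>
  have "inj_on f D"
    by (auto simp: inj_on_def f_def)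
  then have card: "card (solutions k l) = card D"
    by (simp add: sol card_image)
  have "finite (solutions k l) \<and> card (solutions k l) = card {d. d > 0 \<and> d dvd n} \<and>
      (\<forall>(x, y) \<in> solutions k l. \<exists>d. d > 0 \<and> d dvd n \<and> x = k + l * (n div d) \<and> y = k * l + d)"
    using \<open>finite D\<close> card D_pos by (auto simp: D sol) (auto simp: f_def D_def)
  moreover have "card (solutions k l) = 2 \<and>
      solutions k l = {(k + l * n, k * l + 1), (k + l, k * l + n)}" if "prime n"
  proof -
    have "D = {1, n}" "n \<noteq> 1"
      using that divisors_of_prime_nat by (auto simp: D_def)
    then show ?thesis
      using \<open>n > 0\<close> by (simp add: card) (simp add: sol f_def)
  qed
  moreover have "card (solutions k l) = 4 \<and> solutions k l =
      {(k + l * n, k * l + 1), (k + l, k * l + n), (k + l * q, k * l + p), (k + l * p, k * l + q)}"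
    if "prime p" "prime q" "p \<noteq> q" "n = p * q" for p q
  proof -
    have gt: "p > 1" "q > 1"
      using that prime_gt_1_nat by auto
    have DD: "D = {1, n, p, q}"
      using divisors_of_prime_mult_prime_nat that by (simp add: D_def)
    \<comment> \<open>The inequalities keep the four divisors distinct for the count; the quotients
      show that the divisors \<open>p\<close> and \<open>q\<close> have each other as cofactor,
      which explains the crossed pairs.\<close>
    moreover have "n \<noteq> 1" "n \<noteq> p" "n \<noteq> q" "n div p = q" "n div q = p"
      using gt by (auto simp: that)
    ultimately show ?thesis
      using gt \<open>p \<noteq> q\<close> \<open>n > 0\<close> by (simp add: card) (simp add: sol f_def)
  qed
  ultimately show ?thesis
    unfolding n_def by blast
qed

end
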